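(* Let $d:\mathbb{R}\to[0,\infty)\subset\mathbb{R}$ and $h:\mathbb{R}\to\mathbb{R}$ be continuously differentiable. Then the map $$f_{h,d}:C^1\to\mathbb{R},\qquad f_{h,d}(\phi)=h(\phi(-d(\phi(0)))),$$ is $C^1_F$-smooth and has property (e).
   Context: Here $C$ is the Fréchet space of continuous functions $(-\infty,0]\to\mathbb{R}$ with the topology of locally uniform convergence, and $C^1$ is the Fréchet space of continuously differentiable functions $(-\infty,0]\to\mathbb{R}$ with the topology of locally uniform convergence of functions and their derivatives. For topological vector spaces $V,W$, $L_c(V,W)$ denotes the vector space of continuous linear maps $V\to W$; the topology $\beta$ on $L_c(V,W)$ is that of uniform convergence on bounded sets (basic neighbourhoods of $0$: $\{A\in L_c(V,W): AB\subset N\}$ with $B\subset V$ bounded and $N$ a neighbourhood of $0$ in $W$). A continuous map $f:V\supset U\to W$, $U$ open, is $C^1_F$-smooth if all directional derivatives $Df(u)v=\lim_{0\ne t\to0}\frac1t(f(u+tv)-f(u))$, $u\in U$, $v\in V$, exist, each $Df(u):V\to W$ is linear and continuous, and $U\ni u\mapsto Df(u)\in L_c(V,W)$ is continuous with respect to $\beta$. Property (e) for a map $f:C^1\supset U\to\mathbb{R}$: each derivative $Df(\phi):C^1\to\mathbb{R}$, $\phi\in U$, has a linear extension $D_ef(\phi):C\to\mathbb{R}$, and the map $U\times C\ni(\phi,\chi)\mapsto D_ef(\phi)\chi\in\mathbb{R}$ is continuous. *)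

theory Defs
  imports "HOL-Analysis.Analysis"
begin

section \<open>Real topological vector spaces\<close>

class real_tvs = real_vector + topological_ab_group_add +
  assumes tendsto_scaleR_nhds:
    "LIM x (nhds a \<times>\<^sub>F nhds u). fst x *\<^sub>R snd x :> nhds (a *\<^sub>R u)"

instance real_normed_vector \<subseteq> real_tvs
proof
  fix a :: real and u :: 'a
  show "LIM x (nhds a \<times>\<^sub>F nhds u). fst x *\<^sub>R snd x :> nhds (a *\<^sub>R u)"
    unfolding nhds_prod[symmetric]
    using tendsto_fst[OF filterlim_ident, of "(a,u)"] tendsto_snd[OF filterlim_ident, of "(a,u)"]
    by (simp add: tendsto_scaleR)
qed

definition tvs_bounded :: "'a::real_tvs set \<Rightarrow> bool" where
  "tvs_bounded B \<longleftrightarrow> (\<forall>N. open N \<and> 0 \<in> N \<longrightarrow> (\<exists>r>0. \<forall>s\<ge>r. B \<subseteq> (*\<^sub>R) s ` N))"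

definition Lc :: "('a::real_tvs \<Rightarrow> 'b::real_tvs) set" where
  "Lc = {A. linear A \<and> continuous_on UNIV A}"

text \<open>A set is \<open>\<beta>\<close>-open if with each of its points it contains a translate of one of the basic
  neighbourhoods of \<open>0\<close>; lemma \<open>beta_nhd_zero\<close> below confirms that these basic sets are
  neighbourhoods of \<open>0\<close> in the resulting topology.\<close>

definition beta_open :: "('a::real_tvs \<Rightarrow> 'b::real_tvs) set \<Rightarrow> bool" where
  "beta_open S \<longleftrightarrow> S \<subseteq> Lc \<and>
     (\<forall>A\<in>S. \<exists>B N. tvs_bounded B \<and> open N \<and> 0 \<in> N \<and>
        (\<forall>A'\<in>Lc. (\<lambda>v. A' v - A v) ` B \<subseteq> N \<longrightarrow> A' \<in> S))"

definition beta_topology :: "('a::real_tvs \<Rightarrow> 'b::real_tvs) topology" where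
  "beta_topology = topology beta_open"

lemma tvs_bounded_empty: "tvs_bounded {}"
  by (auto simp: tvs_bounded_def intro!: exI[of _ 1])

lemma tvs_bounded_Un:
  assumes "tvs_bounded B" "tvs_bounded C"
  shows "tvs_bounded (B \<union> C)"
  unfolding tvs_bounded_def
proof (intro allI impI)
  fix N :: "'a set" assume N: "open N \<and> 0 \<in> N"
  obtain r where r: "r > 0" "\<forall>s\<ge>r. B \<subseteq> (*\<^sub>R) s ` N"
    using assms(1) N unfolding tvs_bounded_def by blast
  obtain q where q: "q > 0" "\<forall>s\<ge>q. C \<subseteq> (*\<^sub>R) s ` N"
    using assms(2) N unfolding tvs_bounded_def by blast
  show "\<exists>r>0. \<forall>s\<ge>r. B \<union> C \<subseteq> (*\<^sub>R) s ` N"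
    using r q by (intro exI[of _ "max r q"]) auto
qed

lemma istopology_beta_open: "istopology beta_open"
  unfolding istopology_def
proof (intro conjI allI impI)
  fix S T :: "('a \<Rightarrow> 'b) set"
  assume S: "beta_open S" and T: "beta_open T"
  show "beta_open (S \<inter> T)"
    unfolding beta_open_def
  proof (intro conjI ballI)
    show "S \<inter> T \<subseteq> Lc" using S unfolding beta_open_def by blast
    fix A assume A: "A \<in> S \<inter> T"
    obtain B N where 1: "tvs_bounded B" "open N" "0 \<in> N"
        "\<forall>A'\<in>Lc. (\<lambda>v. A' v - A v) ` B \<subseteq> N \<longrightarrow> A' \<in> S"
      using S A unfolding beta_open_def by (meson IntD1)
    obtain C M where 2: "tvs_bounded C" "open M" "0 \<in> M"
        "\<forall>A'\<in>Lc. (\<lambda>v. A' v - A v) ` C \<subseteq> M \<longrightarrow> A' \<in> T"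
      using T A unfolding beta_open_def by (meson IntD2)
    show "\<exists>B N. tvs_bounded B \<and> open N \<and> 0 \<in> N \<and>
        (\<forall>A'\<in>Lc. (\<lambda>v. A' v - A v) ` B \<subseteq> N \<longrightarrow> A' \<in> S \<inter> T)"
      using 1 2 tvs_bounded_Un[of B C]
      by (intro exI[of _ "B \<union> C"] exI[of _ "N \<inter> M"]) (simp add: image_Un open_Int)
  qed
next
  fix K :: "('a \<Rightarrow> 'b) set set"
  assume K: "\<forall>S\<in>K. beta_open S"
  show "beta_open (\<Union>K)"
    unfolding beta_open_def
  proof (intro conjI ballI)
    show "\<Union>K \<subseteq> Lc" using K unfolding beta_open_def by blast
    fix A assume "A \<in> \<Union>K"
    then obtain S where S: "S \<in> K" "A \<in> S" by blast
    then obtain B N where "tvs_bounded B" "open N" "0 \<in> N"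
        "\<forall>A'\<in>Lc. (\<lambda>v. A' v - A v) ` B \<subseteq> N \<longrightarrow> A' \<in> S"
      using K unfolding beta_open_def by meson
    with S show "\<exists>B N. tvs_bounded B \<and> open N \<and> 0 \<in> N \<and>
        (\<forall>A'\<in>Lc. (\<lambda>v. A' v - A v) ` B \<subseteq> N \<longrightarrow> A' \<in> \<Union>K)"
      by blast
  qed
qed

lemma openin_beta_topology: "openin beta_topology S \<longleftrightarrow> beta_open S"
  by (simp add: beta_topology_def istopology_beta_open topology_inverse')

lemma zero_in_Lc: "(\<lambda>_. 0) \<in> Lc"
  by (simp add: Lc_def linear_zero)

lemma topspace_beta_topology: "topspace beta_topology = Lc"
proof -
  have "beta_open Lc"
    unfolding beta_open_def using tvs_bounded_empty by blast
  then show ?thesis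
    unfolding topspace_def openin_beta_topology by (auto simp: beta_open_def)
qed

lemma beta_nhd_zero:
  fixes B :: "'a::real_tvs set" and N :: "'b::real_tvs set"
  assumes B: "tvs_bounded B" and N: "open N" "0 \<in> N"
  shows "\<exists>G. openin beta_topology G \<and> (\<lambda>_. 0) \<in> G \<and> G \<subseteq> {A \<in> Lc. A ` B \<subseteq> N}"
proof -
  have half: "\<exists>P. open P \<and> 0 \<in> P \<and> (\<forall>x\<in>P. \<forall>y\<in>P. x + y \<in> M)"
    if M: "open M" "0 \<in> M" for M :: "'b set"
  proof -
    have "LIM x (nhds (0::'b) \<times>\<^sub>F nhds 0). fst x + snd x :> nhds (0 + 0)"
      by (rule tendsto_add_Pair)
    moreover have "eventually (\<lambda>x. x \<in> M) (nhds (0 + 0 :: 'b))"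
      using M by (auto simp: eventually_nhds)
    ultimately have "eventually (\<lambda>x. fst x + snd x \<in> M) (nhds (0::'b) \<times>\<^sub>F nhds 0)"
      by (rule filterlim_iff[THEN iffD1, rule_format])
    then obtain Pf Pg where P: "eventually Pf (nhds (0::'b))" "eventually Pg (nhds (0::'b))"
        "\<And>x y. Pf x \<Longrightarrow> Pg y \<Longrightarrow> x + y \<in> M"
      unfolding eventually_prod_filter by auto
    have "eventually (\<lambda>x. Pf x \<and> Pg x) (nhds (0::'b))"
      using P by (simp add: eventually_conj)
    then show ?thesis
      unfolding eventually_nhds using P(3) by meson
  qed
  define G where "G = {A \<in> Lc. \<exists>P. open P \<and> 0 \<in> P \<and> (\<forall>v\<in>B. \<forall>x\<in>P. A v + x \<in> N)}"
  have "beta_open G"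
    unfolding beta_open_def
  proof (intro conjI ballI)
    show "G \<subseteq> Lc" by (auto simp: G_def)
    fix A assume "A \<in> G"
    then obtain P where P: "open P" "0 \<in> P" "\<And>v x. v \<in> B \<Longrightarrow> x \<in> P \<Longrightarrow> A v + x \<in> N"
      by (auto simp: G_def)
    obtain Q where Q: "open Q" "0 \<in> Q" "\<And>x y. x \<in> Q \<Longrightarrow> y \<in> Q \<Longrightarrow> x + y \<in> P"
      using half[OF P(1,2)] by blast
    have "A' \<in> G" if A': "A' \<in> Lc" "(\<lambda>v. A' v - A v) ` B \<subseteq> Q" for A'
    proof -
      have "A' v + x \<in> N" if "v \<in> B" "x \<in> Q" for v x
      proof -
        have "A v + ((A' v - A v) + x) \<in> N"
          using A'(2) that by (intro P(3) Q(3)) auto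
        then show ?thesis by (simp add: algebra_simps)
      qed
      then show ?thesis using A'(1) Q(1,2) unfolding G_def by blast
    qed
    then show "\<exists>B N. tvs_bounded B \<and> open N \<and> 0 \<in> N \<and>
        (\<forall>A'\<in>Lc. (\<lambda>v. A' v - A v) ` B \<subseteq> N \<longrightarrow> A' \<in> G)"
      using B Q(1,2) by blast
  qed
  moreover have "(\<lambda>_. 0) \<in> G"
    using N zero_in_Lc by (auto simp: G_def)
  moreover have "G \<subseteq> {A \<in> Lc. A ` B \<subseteq> N}"
    by (force simp: G_def)
  ultimately show ?thesis
    by (auto simp: openin_beta_topology)
qed


section \<open>\<open>C\<^sup>1\<^sub>F\<close>-smoothness\<close>

text \<open>Maps on an open set \<open>U\<close> are represented by total functions whose values outside \<open>U\<close> are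
  irrelevant: for \<open>u \<in> U\<close> the limits at \<open>t \<rightarrow> 0\<close> only involve values in \<open>U\<close>.\<close>

definition diff_quot :: "('a::real_tvs \<Rightarrow> 'b::real_tvs) \<Rightarrow> 'a \<Rightarrow> 'a \<Rightarrow> real \<Rightarrow> 'b" where
  "diff_quot f u v t = (1 / t) *\<^sub>R (f (u + t *\<^sub>R v) - f u)"

definition dir_deriv :: "('a::real_tvs \<Rightarrow> 'b::{real_tvs,t2_space}) \<Rightarrow> 'a \<Rightarrow> 'a \<Rightarrow> 'b" where
  "dir_deriv f u v = Lim (at 0) (diff_quot f u v)"

definition C1F_smooth_on :: "'a::real_tvs set \<Rightarrow> ('a \<Rightarrow> 'b::{real_tvs,t2_space}) \<Rightarrow> bool" where
  "C1F_smooth_on U f \<longleftrightarrow>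
     open U \<and> continuous_on U f \<and>
     (\<forall>u\<in>U. \<forall>v. \<exists>w. (diff_quot f u v \<longlongrightarrow> w) (at 0)) \<and>
     (\<forall>u\<in>U. dir_deriv f u \<in> Lc) \<and>
     continuous_map (top_of_set U) beta_topology (dir_deriv f)"


section \<open>The space \<open>C\<close>\<close>

text \<open>A function on \<open>(-\<infinity>,0]\<close> is represented by its extension by \<open>0\<close> to the positive reals.\<close>

typedef chist = "{f :: real \<Rightarrow> real. continuous_on {..0} f \<and> (\<forall>t>0. f t = 0)}"
  morphisms c_fun Abs_chist
  by (rule exI[of _ "\<lambda>_. 0"]) auto

setup_lifting type_definition_chist

instantiation chist :: real_vector
begin

lift_definition zero_chist :: chist is "\<lambda>_. 0" by auto
lift_definition plus_chist :: "chist \<Rightarrow> chist \<Rightarrow> chist" is "\<lambda>f g t. f t + g t"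
  by (auto intro: continuous_intros)
lift_definition minus_chist :: "chist \<Rightarrow> chist \<Rightarrow> chist" is "\<lambda>f g t. f t - g t"
  by (auto intro: continuous_intros)
lift_definition uminus_chist :: "chist \<Rightarrow> chist" is "\<lambda>f t. - f t"
  by (auto intro: continuous_intros)
lift_definition scaleR_chist :: "real \<Rightarrow> chist \<Rightarrow> chist" is "\<lambda>c f t. c * f t"
  by (auto intro: continuous_intros)

instance
  by standard (transfer; simp add: fun_eq_iff algebra_simps)+

end

lemma c_fun_pos: "t > 0 \<Longrightarrow> c_fun \<phi> t = 0"
  using c_fun[of \<phi>] by simp

lemma continuous_on_c_fun: "continuous_on {..0} (c_fun \<phi>)"
  using c_fun[of \<phi>] by simp

lemma continuous_on_c_fun_subset: "K \<subseteq> {..0} \<Longrightarrow> continuous_on K (c_fun \<phi>)"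
  using continuous_on_c_fun continuous_on_subset by blast

text \<open>Locally uniform convergence on \<open>(-\<infinity>,0]\<close> is uniform convergence on its compact subsets.\<close>

definition c_ball :: "real set \<Rightarrow> real \<Rightarrow> chist \<Rightarrow> chist set" where
  "c_ball K e \<phi> = {\<psi>. \<forall>t\<in>K. \<bar>c_fun \<psi> t - c_fun \<phi> t\<bar> < e}"

instantiation chist :: topological_space
begin

definition open_chist :: "chist set \<Rightarrow> bool" where
  "open_chist U \<longleftrightarrow>
     (\<forall>\<phi>\<in>U. \<exists>K e. compact K \<and> K \<subseteq> {..0} \<and> e > 0 \<and> c_ball K e \<phi> \<subseteq> U)"

instance
proof
  show "open (UNIV :: chist set)"
    unfolding open_chist_def using compact_empty zero_less_one by blast
next
  fix S T :: "chist set"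
  assume S: "open S" and T: "open T"
  show "open (S \<inter> T)"
    unfolding open_chist_def
  proof
    fix \<phi> assume \<phi>: "\<phi> \<in> S \<inter> T"
    obtain K e where 1: "compact K" "K \<subseteq> {..0}" "e > 0" "c_ball K e \<phi> \<subseteq> S"
      using S \<phi> unfolding open_chist_def by (meson IntD1)
    obtain L d where 2: "compact L" "L \<subseteq> {..0}" "d > 0" "c_ball L d \<phi> \<subseteq> T"
      using T \<phi> unfolding open_chist_def by (meson IntD2)
    have "c_ball (K \<union> L) (min e d) \<phi> \<subseteq> c_ball K e \<phi> \<inter> c_ball L d \<phi>"
      by (auto simp: c_ball_def)
    with 1 2 show "\<exists>K e. compact K \<and> K \<subseteq> {..0} \<and> e > 0 \<and> c_ball K e \<phi> \<subseteq> S \<inter> T"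
      by (intro exI[of _ "K \<union> L"] exI[of _ "min e d"]) auto
  qed
next
  fix \<K> :: "chist set set"
  assume "\<forall>S\<in>\<K>. open S"
  then show "open (\<Union>\<K>)"
    unfolding open_chist_def by (meson Union_iff Union_upper subset_trans)
qed

end

lemma open_c_ball:
  assumes K: "compact K" "K \<subseteq> {..0}"
  shows "open (c_ball K e \<phi>)"
  unfolding open_chist_def
proof
  fix \<psi> assume \<psi>: "\<psi> \<in> c_ball K e \<phi>"
  show "\<exists>L d. compact L \<and> L \<subseteq> {..0} \<and> d > 0 \<and> c_ball L d \<psi> \<subseteq> c_ball K e \<phi>"
  proof (cases "K = {}")
    case True
    then have "c_ball K 1 \<psi> \<subseteq> c_ball K e \<phi>" by (simp add: c_ball_def)
    then show ?thesis using K zero_less_one by blast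
  next
    case False
    have "continuous_on K (\<lambda>t. \<bar>c_fun \<psi> t - c_fun \<phi> t\<bar>)"
      using K by (intro continuous_intros continuous_on_c_fun_subset)
    from continuous_attains_sup[OF K(1) False this]
    obtain s where s: "s \<in> K"
      "\<And>t. t \<in> K \<Longrightarrow> \<bar>c_fun \<psi> t - c_fun \<phi> t\<bar> \<le> \<bar>c_fun \<psi> s - c_fun \<phi> s\<bar>" by blast
    define d where "d = e - \<bar>c_fun \<psi> s - c_fun \<phi> s\<bar>"
    have "d > 0" using \<psi> s(1) by (auto simp: d_def c_ball_def)
    moreover have "c_ball K d \<psi> \<subseteq> c_ball K e \<phi>"
    proof
      fix \<eta> assume \<eta>: "\<eta> \<in> c_ball K d \<psi>"
      have "\<bar>c_fun \<eta> t - c_fun \<phi> t\<bar> < e" if "t \<in> K" for t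
      proof -
        have "\<bar>c_fun \<eta> t - c_fun \<psi> t\<bar> < d" using \<eta> that by (auto simp: c_ball_def)
        then show ?thesis using s(2)[OF that] unfolding d_def by linarith
      qed
      then show "\<eta> \<in> c_ball K e \<phi>" by (simp add: c_ball_def)
    qed
    ultimately show ?thesis using K by blast
  qed
qed

lemma tendsto_chist_iff:
  "(X \<longlongrightarrow> \<phi>) F \<longleftrightarrow>
     (\<forall>K. compact K \<longrightarrow> K \<subseteq> {..0} \<longrightarrow> uniform_limit K (\<lambda>x. c_fun (X x)) (c_fun \<phi>) F)"
proof (intro iffI allI impI)
  fix K :: "real set" assume X: "(X \<longlongrightarrow> \<phi>) F" and K: "compact K" "K \<subseteq> {..0}"
  show "uniform_limit K (\<lambda>x. c_fun (X x)) (c_fun \<phi>) F"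
  proof (rule uniform_limitI)
    fix e :: real assume "e > 0"
    then have "\<phi> \<in> c_ball K e \<phi>" by (simp add: c_ball_def)
    then have "eventually (\<lambda>x. X x \<in> c_ball K e \<phi>) F"
      using X open_c_ball[OF K] by (simp add: topological_tendstoD)
    then show "eventually (\<lambda>x. \<forall>t\<in>K. dist (c_fun (X x) t) (c_fun \<phi> t) < e) F"
      by (simp add: c_ball_def dist_real_def)
  qed
next
  assume R: "\<forall>K. compact K \<longrightarrow> K \<subseteq> {..0} \<longrightarrow> uniform_limit K (\<lambda>x. c_fun (X x)) (c_fun \<phi>) F"
  show "(X \<longlongrightarrow> \<phi>) F"
  proof (rule topological_tendstoI)
    fix S assume "open S" "\<phi> \<in> S"
    then obtain K e where K: "compact K" "K \<subseteq> {..0}" "e > 0" "c_ball K e \<phi> \<subseteq> S"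
      unfolding open_chist_def by meson
    have "eventually (\<lambda>x. \<forall>t\<in>K. dist (c_fun (X x) t) (c_fun \<phi> t) < e) F"
      using R K by (simp add: uniform_limitD)
    then show "eventually (\<lambda>x. X x \<in> S) F"
      by eventually_elim (use K(4) in \<open>auto simp: c_ball_def dist_real_def\<close>)
  qed
qed

instance chist :: t2_space
proof
  fix \<phi> \<psi> :: chist assume "\<phi> \<noteq> \<psi>"
  then have "c_fun \<phi> \<noteq> c_fun \<psi>" by (simp add: c_fun_inject)
  then obtain t where t: "c_fun \<phi> t \<noteq> c_fun \<psi> t" by (auto simp: fun_eq_iff)
  have t0: "t \<le> 0"
  proof (rule ccontr)
    assume "\<not> t \<le> 0"
    then have "c_fun \<phi> t = 0" "c_fun \<psi> t = 0" by (simp_all add: c_fun_pos)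
    with t show False by simp
  qed
  define e where "e = \<bar>c_fun \<phi> t - c_fun \<psi> t\<bar> / 2"
  have "c_ball {t} e \<phi> \<inter> c_ball {t} e \<psi> = {}"
  proof (rule ccontr)
    assume "c_ball {t} e \<phi> \<inter> c_ball {t} e \<psi> \<noteq> {}"
    then obtain \<eta> where "\<bar>c_fun \<eta> t - c_fun \<phi> t\<bar> < e" "\<bar>c_fun \<eta> t - c_fun \<psi> t\<bar> < e"
      by (auto simp: c_ball_def)
    moreover have "\<bar>c_fun \<phi> t - c_fun \<psi> t\<bar> \<le> \<bar>c_fun \<eta> t - c_fun \<phi> t\<bar> + \<bar>c_fun \<eta> t - c_fun \<psi> t\<bar>"
      by linarith
    moreover have "False" if "x < z / 2" "y < z / 2" "z \<le> x + y" for x y z :: real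
      using that by linarith
    ultimately show False unfolding e_def by blast
  qed
  moreover have "\<phi> \<in> c_ball {t} e \<phi>" "\<psi> \<in> c_ball {t} e \<psi>"
    using t by (auto simp: c_ball_def e_def)
  moreover have "open (c_ball {t} e \<phi>)" "open (c_ball {t} e \<psi>)"
    using t0 by (auto intro: open_c_ball)
  ultimately show "\<exists>U V. open U \<and> open V \<and> \<phi> \<in> U \<and> \<psi> \<in> V \<and> U \<inter> V = {}"
    by blast
qed

instance chist :: real_tvs
proof
  fix \<phi> \<psi> :: chist and a :: real
  show "LIM x (nhds \<phi> \<times>\<^sub>F nhds \<psi>). fst x + snd x :> nhds (\<phi> + \<psi>)"
    unfolding tendsto_chist_iff plus_chist.rep_eq
    using filterlim_fst[of "nhds \<phi>" "nhds \<psi>"] filterlim_snd[of "nhds \<psi>" "nhds \<phi>"]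
    unfolding tendsto_chist_iff by (auto intro!: uniform_limit_add)
  show "(uminus \<longlongrightarrow> - \<phi>) (nhds \<phi>)"
    using filterlim_ident[of "nhds \<phi>"]
    unfolding tendsto_chist_iff uminus_chist.rep_eq by (auto intro!: uniform_limit_uminus)
  show "LIM x (nhds a \<times>\<^sub>F nhds \<phi>). fst x *\<^sub>R snd x :> nhds (a *\<^sub>R \<phi>)"
    unfolding tendsto_chist_iff scaleR_chist.rep_eq
  proof (intro allI impI)
    fix K :: "real set" assume K: "compact K" "K \<subseteq> {..0}"
    have "uniform_limit K (\<lambda>x _. fst x) (\<lambda>_. a) (nhds a \<times>\<^sub>F nhds \<phi>)"
      using tendstoD[OF filterlim_fst[of "nhds a" "nhds \<phi>"]]
      by (auto intro!: uniform_limitI elim: eventually_mono)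
    moreover have "uniform_limit K (\<lambda>x. c_fun (snd x)) (c_fun \<phi>) (nhds a \<times>\<^sub>F nhds \<phi>)"
      using filterlim_snd[of "nhds \<phi>" "nhds a"] K unfolding tendsto_chist_iff by blast
    moreover have "bounded (c_fun \<phi> ` K)"
      using K by (intro compact_imp_bounded compact_continuous_image continuous_on_c_fun_subset)
    moreover have "bounded ((\<lambda>_. a) ` K)"
      by (rule bounded_subset[of "{a}"]) auto
    ultimately show "uniform_limit K (\<lambda>x t. fst x * c_fun (snd x) t) (\<lambda>t. a * c_fun \<phi> t)
        (nhds a \<times>\<^sub>F nhds \<phi>)"
      by (intro uniform_lim_mult)
  qed
qed


section \<open>The space \<open>C\<^sup>1\<close>\<close>

text \<open>The derivative within \<open>(-\<infinity>,0]\<close> is one-sided at \<open>0\<close> and does not see the extension by \<open>0\<close>.\<close>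

abbreviation hderiv :: "(real \<Rightarrow> real) \<Rightarrow> real \<Rightarrow> real" where
  "hderiv f t \<equiv> vector_derivative f (at t within {..0})"

lemma within_nontrivial: "t \<le> 0 \<Longrightarrow> at t within {..0} \<noteq> bot" for t :: real
proof -
  assume t: "t \<le> 0"
  have "t islimpt {t - 1<..<t}" by (rule islimpt_greaterThanLessThan2) simp
  then have "t islimpt {..0}" by (rule islimpt_subset) (use t in auto)
  then show ?thesis by (simp add: trivial_limit_within)
qed

lemma hderivI: "t \<le> 0 \<Longrightarrow> (f has_vector_derivative D) (at t within {..0}) \<Longrightarrow> hderiv f t = D"
  by (rule vector_derivative_within[OF within_nontrivial])

definition c1_on_hist :: "(real \<Rightarrow> real) \<Rightarrow> bool" where
  "c1_on_hist f \<longleftrightarrow> (\<forall>t\<le>0. f differentiable (at t within {..0})) \<and> continuous_on {..0} (hderiv f)"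

lemma c1_on_hist_deriv:
  "c1_on_hist f \<Longrightarrow> t \<le> 0 \<Longrightarrow> (f has_vector_derivative hderiv f t) (at t within {..0})"
  unfolding c1_on_hist_def using vector_derivative_works by blast

lemma c1_on_histI:
  assumes "\<And>t. t \<le> 0 \<Longrightarrow> (f has_vector_derivative D t) (at t within {..0})"
    and "continuous_on {..0} D"
  shows "c1_on_hist f"
proof -
  have "continuous_on {..0} (hderiv f) \<longleftrightarrow> continuous_on {..0} D"
    using assms(1) by (intro continuous_on_cong) (auto intro: hderivI)
  then show ?thesis
    unfolding c1_on_hist_def using assms by (auto intro: differentiableI_vector)
qed

lemma c1_on_hist_imp_continuous: "c1_on_hist f \<Longrightarrow> continuous_on {..0} f"
  unfolding c1_on_hist_def continuous_on_eq_continuous_within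
  by (auto intro: differentiable_imp_continuous_within)

lemma c1_on_hist_deriv_continuous: "c1_on_hist f \<Longrightarrow> continuous_on {..0} (hderiv f)"
  by (simp add: c1_on_hist_def)

lemma c1_on_hist_zero: "c1_on_hist (\<lambda>_. 0)"
  by (rule c1_on_histI[where D = "\<lambda>_. 0"]) auto

typedef c1hist = "{f :: real \<Rightarrow> real. c1_on_hist f \<and> (\<forall>t>0. f t = 0)}"
  morphisms c1_fun Abs_c1hist
  using c1_on_hist_zero by auto

setup_lifting type_definition_c1hist

instantiation c1hist :: real_vector
begin

lift_definition zero_c1hist :: c1hist is "\<lambda>_. 0"
  by (simp add: c1_on_hist_zero)
lift_definition plus_c1hist :: "c1hist \<Rightarrow> c1hist \<Rightarrow> c1hist" is "\<lambda>f g t. f t + g t"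
  subgoal premises prems for f g
  proof -
    have "c1_on_hist (\<lambda>t. f t + g t)"
      by (rule c1_on_histI[where D = "\<lambda>t. hderiv f t + hderiv g t"])
         (use prems in \<open>simp_all add: has_vector_derivative_add c1_on_hist_deriv continuous_on_add c1_on_hist_deriv_continuous\<close>)
    then show ?thesis using prems by simp
  qed
  done
lift_definition minus_c1hist :: "c1hist \<Rightarrow> c1hist \<Rightarrow> c1hist" is "\<lambda>f g t. f t - g t"
  subgoal premises prems for f g
  proof -
    have "c1_on_hist (\<lambda>t. f t - g t)"
      by (rule c1_on_histI[where D = "\<lambda>t. hderiv f t - hderiv g t"])
         (use prems in \<open>simp_all add: has_vector_derivative_diff c1_on_hist_deriv continuous_on_diff c1_on_hist_deriv_continuous\<close>)
    then show ?thesis using prems by simp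
  qed
  done
lift_definition uminus_c1hist :: "c1hist \<Rightarrow> c1hist" is "\<lambda>f t. - f t"
  subgoal premises prems for f
  proof -
    have "c1_on_hist (\<lambda>t. - f t)"
      by (rule c1_on_histI[where D = "\<lambda>t. - hderiv f t"])
         (use prems in \<open>simp_all add: has_vector_derivative_minus c1_on_hist_deriv continuous_on_minus c1_on_hist_deriv_continuous\<close>)
    then show ?thesis using prems by simp
  qed
  done
lift_definition scaleR_c1hist :: "real \<Rightarrow> c1hist \<Rightarrow> c1hist" is "\<lambda>c f t. c * f t"
  subgoal premises prems for c f
  proof -
    have "c1_on_hist (\<lambda>t. c * f t)"
      by (rule c1_on_histI[where D = "\<lambda>t. c * hderiv f t"])
         (use prems in \<open>simp_all add: has_vector_derivative_mult_right c1_on_hist_deriv continuous_on_mult_left c1_on_hist_deriv_continuous\<close>)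
    then show ?thesis using prems by simp
  qed
  done

instance
  by standard (simp_all add: c1_fun_inject[symmetric] zero_c1hist.rep_eq plus_c1hist.rep_eq
      minus_c1hist.rep_eq uminus_c1hist.rep_eq scaleR_c1hist.rep_eq fun_eq_iff algebra_simps)

end

lift_definition c_of_c1 :: "c1hist \<Rightarrow> chist" is "\<lambda>f. f"
  by (simp add: c1_on_hist_imp_continuous)

lift_definition c1_deriv :: "c1hist \<Rightarrow> chist" is "\<lambda>f t. if t \<le> 0 then hderiv f t else 0"
  subgoal premises prems for f
  proof -
    have "continuous_on {..0} (hderiv f)"
      using prems by (simp add: c1_on_hist_deriv_continuous)
    moreover have "continuous_on {..0} (\<lambda>t. if t \<le> 0 then hderiv f t else 0) \<longleftrightarrow>
        continuous_on {..0} (hderiv f)"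
      by (rule continuous_on_cong) simp_all
    ultimately show ?thesis by simp
  qed
  done

lemma c1_hist_c1_fun: "c1_on_hist (c1_fun \<phi>)"
  using c1_fun[of \<phi>] by simp

lemma c_of_c1_linear: "linear c_of_c1"
  by (rule linearI) (simp_all add: c_fun_inject[symmetric] c_of_c1.rep_eq fun_eq_iff
      plus_chist.rep_eq plus_c1hist.rep_eq scaleR_chist.rep_eq scaleR_c1hist.rep_eq)

lemma c1_deriv_linear: "linear c1_deriv"
proof (rule linearI)
  fix \<phi> \<psi> :: c1hist and a :: real
  have "hderiv (c1_fun (\<phi> + \<psi>)) t = hderiv (c1_fun \<phi>) t + hderiv (c1_fun \<psi>) t" if "t \<le> 0" for t
    unfolding plus_c1hist.rep_eq using that
    by (intro hderivI has_vector_derivative_add c1_on_hist_deriv c1_hist_c1_fun)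
  then show "c1_deriv (\<phi> + \<psi>) = c1_deriv \<phi> + c1_deriv \<psi>"
    by (simp add: c_fun_inject[symmetric] c1_deriv.rep_eq plus_chist.rep_eq fun_eq_iff)
  have "hderiv (c1_fun (a *\<^sub>R \<phi>)) t = a * hderiv (c1_fun \<phi>) t" if "t \<le> 0" for t
    unfolding scaleR_c1hist.rep_eq using that
    by (intro hderivI has_vector_derivative_mult_right c1_on_hist_deriv c1_hist_c1_fun)
  then show "c1_deriv (a *\<^sub>R \<phi>) = a *\<^sub>R c1_deriv \<phi>"
    by (simp add: c_fun_inject[symmetric] c1_deriv.rep_eq scaleR_chist.rep_eq fun_eq_iff)
qed

text \<open>The topology of locally uniform convergence of functions and of their derivatives is the
  initial topology with respect to \<open>\<phi> \<mapsto> (\<phi>, \<phi>')\<close>; see \<open>tendsto_c1hist_iff_uniform\<close>.\<close>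

definition c1_jet :: "c1hist \<Rightarrow> chist \<times> chist" where
  "c1_jet \<phi> = (c_of_c1 \<phi>, c1_deriv \<phi>)"

instantiation c1hist :: topological_space
begin

definition open_c1hist :: "c1hist set \<Rightarrow> bool" where
  "open_c1hist U \<longleftrightarrow> (\<exists>V. open V \<and> U = c1_jet -` V)"

lemma open_c1histI: "open V \<Longrightarrow> open (c1_jet -` V)"
  unfolding open_c1hist_def by (rule exI[of _ V], rule conjI, assumption, rule refl)

lemma open_c1histE:
  fixes U :: "c1hist set"
  assumes "open U" obtains V where "open V" "U = c1_jet -` V"
  using assms unfolding open_c1hist_def by (elim exE conjE)

instance
proof
  show "open (UNIV :: c1hist set)"
    using open_c1histI[OF open_UNIV] by (simp only: vimage_UNIV)
next
  fix S T :: "c1hist set" assume ST: "open S" "open T"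
  obtain V where V: "open V" "S = c1_jet -` V" using ST(1) by (rule open_c1histE)
  obtain W where W: "open W" "T = c1_jet -` W" using ST(2) by (rule open_c1histE)
  show "open (S \<inter> T)"
    using open_c1histI[OF open_Int[OF V(1) W(1)]] by (simp only: V(2) W(2) vimage_Int)
next
  fix K :: "c1hist set set" assume K: "\<forall>S\<in>K. open S"
  define L where "L = {V. open V \<and> c1_jet -` V \<in> K}"
  have "\<Union>K = c1_jet -` \<Union>L"
  proof (rule set_eqI, rule iffI)
    fix \<phi> assume "\<phi> \<in> \<Union>K"
    then obtain S where S: "S \<in> K" "\<phi> \<in> S" by (rule UnionE)
    have "open S" using K S(1) by (rule bspec)
    then obtain V where V: "open V" "S = c1_jet -` V" by (rule open_c1histE)
    have "V \<in> L" using S(1) V(1) unfolding L_def V(2) by (rule_tac CollectI, rule_tac conjI)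
    moreover have "c1_jet \<phi> \<in> V" using S(2) unfolding V(2) by (rule vimageD)
    ultimately have "c1_jet \<phi> \<in> \<Union>L" by (rule UnionI)
    then show "\<phi> \<in> c1_jet -` \<Union>L" by (rule vimageI2)
  next
    fix \<phi> assume "\<phi> \<in> c1_jet -` \<Union>L"
    then have "c1_jet \<phi> \<in> \<Union>L" by (rule vimageD)
    then obtain V where V: "V \<in> L" "c1_jet \<phi> \<in> V" by (rule UnionE)
    have "c1_jet -` V \<in> K" using V(1) unfolding L_def by simp
    then show "\<phi> \<in> \<Union>K" using V(2) by blast
  qed
  moreover have "open (\<Union>L)"
    by (rule open_Union) (simp add: L_def)
  ultimately show "open (\<Union>K)"
    using open_c1histI[of "\<Union>L"] by (simp only:)
qed

end

lemma tendsto_c1hist_iff: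
  "(X \<longlongrightarrow> \<phi>) F \<longleftrightarrow>
     ((\<lambda>x. c_of_c1 (X x)) \<longlongrightarrow> c_of_c1 \<phi>) F \<and> ((\<lambda>x. c1_deriv (X x)) \<longlongrightarrow> c1_deriv \<phi>) F"
proof -
  have "(X \<longlongrightarrow> \<phi>) F \<longleftrightarrow> ((\<lambda>x. c1_jet (X x)) \<longlongrightarrow> c1_jet \<phi>) F"
  proof
    assume X: "(X \<longlongrightarrow> \<phi>) F"
    show "((\<lambda>x. c1_jet (X x)) \<longlongrightarrow> c1_jet \<phi>) F"
    proof (rule topological_tendstoI)
      fix V assume V: "open V" "c1_jet \<phi> \<in> V"
      show "eventually (\<lambda>x. c1_jet (X x) \<in> V) F"
        using topological_tendstoD[OF X open_c1histI[OF V(1)]] V(2) by simp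
    qed
  next
    assume X: "((\<lambda>x. c1_jet (X x)) \<longlongrightarrow> c1_jet \<phi>) F"
    show "(X \<longlongrightarrow> \<phi>) F"
    proof (rule topological_tendstoI)
      fix U assume U: "open U" "\<phi> \<in> U"
      obtain V where V: "open V" "U = c1_jet -` V" using U(1) by (rule open_c1histE)
      show "eventually (\<lambda>x. X x \<in> U) F"
        using topological_tendstoD[OF X V(1)] U(2) unfolding V(2) by simp
    qed
  qed
  also have "\<dots> \<longleftrightarrow> ((\<lambda>x. c_of_c1 (X x)) \<longlongrightarrow> c_of_c1 \<phi>) F \<and> ((\<lambda>x. c1_deriv (X x)) \<longlongrightarrow> c1_deriv \<phi>) F"
  proof
    assume "((\<lambda>x. c1_jet (X x)) \<longlongrightarrow> c1_jet \<phi>) F"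
    from tendsto_fst[OF this] tendsto_snd[OF this]
    show "((\<lambda>x. c_of_c1 (X x)) \<longlongrightarrow> c_of_c1 \<phi>) F \<and> ((\<lambda>x. c1_deriv (X x)) \<longlongrightarrow> c1_deriv \<phi>) F"
      by (simp add: c1_jet_def)
  next
    assume "((\<lambda>x. c_of_c1 (X x)) \<longlongrightarrow> c_of_c1 \<phi>) F \<and> ((\<lambda>x. c1_deriv (X x)) \<longlongrightarrow> c1_deriv \<phi>) F"
    then show "((\<lambda>x. c1_jet (X x)) \<longlongrightarrow> c1_jet \<phi>) F"
      unfolding c1_jet_def by (auto intro: tendsto_Pair)
  qed
  finally show ?thesis .
qed

lemma tendsto_c1hist_iff_uniform:
  "(X \<longlongrightarrow> \<phi>) F \<longleftrightarrow>
     (\<forall>K. compact K \<longrightarrow> K \<subseteq> {..0} \<longrightarrow>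
        uniform_limit K (\<lambda>x. c1_fun (X x)) (c1_fun \<phi>) F \<and>
        uniform_limit K (\<lambda>x. hderiv (c1_fun (X x))) (hderiv (c1_fun \<phi>)) F)"
proof -
  have "uniform_limit K (\<lambda>x. c_fun (c1_deriv (X x))) (c_fun (c1_deriv \<phi>)) F \<longleftrightarrow>
      uniform_limit K (\<lambda>x. hderiv (c1_fun (X x))) (hderiv (c1_fun \<phi>)) F" if "K \<subseteq> {..0}" for K
    using that unfolding c1_deriv.rep_eq by (intro uniform_limit_cong') auto
  then show ?thesis
    unfolding tendsto_c1hist_iff tendsto_chist_iff c_of_c1.rep_eq by blast
qed

instance c1hist :: t2_space
proof
  fix \<phi> \<psi> :: c1hist assume "\<phi> \<noteq> \<psi>"
  then have "c_of_c1 \<phi> \<noteq> c_of_c1 \<psi>"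
    by (simp add: c_fun_inject[symmetric] c_of_c1.rep_eq c1_fun_inject)
  from hausdorff[OF this] obtain U V where
    UV: "open U" "open V" "c_of_c1 \<phi> \<in> U" "c_of_c1 \<psi> \<in> V" "U \<inter> V = {}"
    by (elim exE conjE)
  show "\<exists>U V. open U \<and> open V \<and> \<phi> \<in> U \<and> \<psi> \<in> V \<and> U \<inter> V = {}"
  proof (intro exI conjI)
    show "open (c1_jet -` (U \<times> UNIV))"
      by (rule open_c1histI, rule open_Times, rule UV(1), rule open_UNIV)
    show "open (c1_jet -` (V \<times> UNIV))"
      by (rule open_c1histI, rule open_Times, rule UV(2), rule open_UNIV)
    show "\<phi> \<in> c1_jet -` (U \<times> UNIV)" "\<psi> \<in> c1_jet -` (V \<times> UNIV)"
      using UV(3,4) by (simp_all add: c1_jet_def)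
    show "c1_jet -` (U \<times> UNIV) \<inter> c1_jet -` (V \<times> UNIV) = {}"
      using UV(5) by (auto simp: c1_jet_def)
  qed
qed

instance c1hist :: real_tvs
proof
  fix \<phi> \<psi> :: c1hist and a :: real
  note lin = linear_add[OF c_of_c1_linear] linear_add[OF c1_deriv_linear]
    linear_neg[OF c_of_c1_linear] linear_neg[OF c1_deriv_linear]
    linear_scale[OF c_of_c1_linear] linear_scale[OF c1_deriv_linear]
  have scale: "((\<lambda>x. f x *\<^sub>R X x) \<longlongrightarrow> c *\<^sub>R \<eta>) F"
    if "(f \<longlongrightarrow> c) F" "(X \<longlongrightarrow> \<eta>) F" for f c F and X :: "'z \<Rightarrow> chist" and \<eta>
    using filterlim_compose[OF tendsto_scaleR_nhds, of "\<lambda>x. (f x, X x)" c \<eta> F] that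
    by (simp add: nhds_prod[symmetric] tendsto_Pair)
  show "LIM x (nhds \<phi> \<times>\<^sub>F nhds \<psi>). fst x + snd x :> nhds (\<phi> + \<psi>)"
    using filterlim_fst[of "nhds \<phi>" "nhds \<psi>"] filterlim_snd[of "nhds \<psi>" "nhds \<phi>"]
    unfolding tendsto_c1hist_iff lin by (auto intro!: tendsto_add)
  show "(uminus \<longlongrightarrow> - \<phi>) (nhds \<phi>)"
    using filterlim_ident[of "nhds \<phi>"]
    unfolding tendsto_c1hist_iff lin by (auto intro!: tendsto_minus)
  show "LIM x (nhds a \<times>\<^sub>F nhds \<phi>). fst x *\<^sub>R snd x :> nhds (a *\<^sub>R \<phi>)"
    using filterlim_fst[of "nhds a" "nhds \<phi>"] filterlim_snd[of "nhds \<phi>" "nhds a"]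
    unfolding tendsto_c1hist_iff lin by (auto intro!: scale)
qed


section \<open>Property (e) and the map \<open>f\<^sub>h\<^sub>,\<^sub>d\<close>\<close>

definition property_e :: "c1hist set \<Rightarrow> (c1hist \<Rightarrow> real) \<Rightarrow> bool" where
  "property_e U f \<longleftrightarrow>
     (\<exists>De :: c1hist \<Rightarrow> chist \<Rightarrow> real.
        (\<forall>\<phi>\<in>U. linear (De \<phi>) \<and> (\<forall>\<psi>. De \<phi> (c_of_c1 \<psi>) = dir_deriv f \<phi> \<psi>)) \<and>
        continuous_on (U \<times> UNIV) (\<lambda>(\<phi>, \<eta>). De \<phi> \<eta>))"

definition f_hd :: "(real \<Rightarrow> real) \<Rightarrow> (real \<Rightarrow> real) \<Rightarrow> c1hist \<Rightarrow> real" where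
  "f_hd h d \<phi> = h (c1_fun \<phi> (- d (c1_fun \<phi> 0)))"

end

theory Submission
  imports Defs
begin

text \<open>With \<open>r \<phi> = -d (\<phi> 0)\<close>, the chain rule gives
  \<open>Df(\<phi>) \<eta> = a \<phi> (\<eta> (r \<phi>) - b \<phi> \<eta> 0)\<close>, where \<open>a \<phi> = h' (\<phi> (r \<phi>))\<close> and
  \<open>b \<phi> = \<phi>' (r \<phi>) d' (\<phi> 0)\<close>. This formula makes sense for every \<open>\<eta>\<close> in \<open>C\<close>, and it is jointly
  continuous because evaluation \<open>(\<eta>, t) \<mapsto> \<eta> t\<close> is continuous on \<open>C \<times> (-\<infinity>,0]\<close>. Continuity into
  \<open>\<beta>\<close> holds because a bounded subset of \<open>C\<^sup>1\<close> is uniformly bounded and equi-Lipschitz on each compact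
  interval \<open>[T,0]\<close>, which controls \<open>\<eta> (r \<phi>) - \<eta> (r \<phi>\<^sub>0)\<close> uniformly.\<close>

section \<open>Joint continuity of evaluation on C and C^1\<close>

text \<open>The error splits into \<open>c_fun (X x) (s x) - c_fun \<eta> (s x)\<close>, small by
  uniform convergence on the compact interval [t - 1, 0] that eventually contains
  \<open>s x\<close>, and \<open>c_fun \<eta> (s x) - c_fun \<eta> t\<close>, small by continuity of
  \<eta>. Keeping \<open>s x\<close> non-positive avoids the extension by zero, which may jump at
  0.\<close>

lemma tendsto_c_fun_eval:
  assumes X: "(X \<longlongrightarrow> \<eta>) F" and s: "(s \<longlongrightarrow> t) F" and s0: "\<And>x. s x \<le> 0" and t0: "t \<le> 0"
  shows "((\<lambda>x. c_fun (X x) (s x)) \<longlongrightarrow> c_fun \<eta> t) F"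
proof -
  have unif: "uniform_limit {t - 1..0} (\<lambda>x. c_fun (X x)) (c_fun \<eta>) F"
    using X unfolding tendsto_chist_iff by auto
  have near: "eventually (\<lambda>x. s x \<in> {t - 1..0}) F"
    using order_tendstoD(1)[OF s, of "t - 1"] s0 by (auto elim: eventually_mono)
  have "eventually (\<lambda>x. \<bar>c_fun (X x) (s x) - c_fun \<eta> (s x)\<bar> < e) F" if "e > 0" for e
    using near uniform_limitD[OF unif that] by eventually_elim (auto simp: dist_real_def)
  then have "((\<lambda>x. c_fun (X x) (s x) - c_fun \<eta> (s x)) \<longlongrightarrow> 0) F"
    by (simp add: tendsto_iff dist_real_def)
  moreover have "((\<lambda>x. c_fun \<eta> (s x)) \<longlongrightarrow> c_fun \<eta> t) F"
    using s0 t0 by (intro continuous_on_tendsto_compose[OF continuous_on_c_fun s]) auto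
  ultimately show ?thesis
    by (rule Lim_transform[rotated])
qed

lemma tendsto_c1_fun_eval:
  assumes "(X \<longlongrightarrow> \<phi>) F" "(s \<longlongrightarrow> t) F" "\<And>x. s x \<le> 0" "t \<le> 0"
  shows "((\<lambda>x. c1_fun (X x) (s x)) \<longlongrightarrow> c1_fun \<phi> t) F"
    and "((\<lambda>x. hderiv (c1_fun (X x)) (s x)) \<longlongrightarrow> hderiv (c1_fun \<phi>) t) F"
  using assms tendsto_c_fun_eval[of "\<lambda>x. c_of_c1 (X x)" "c_of_c1 \<phi>" F s t]
    tendsto_c_fun_eval[of "\<lambda>x. c1_deriv (X x)" "c1_deriv \<phi>" F s t]
  by (simp_all add: tendsto_c1hist_iff c_of_c1.rep_eq c1_deriv.rep_eq)

section \<open>Derivatives and bounded sets in C^1\<close>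

lemma c1_fun_has_field_derivative:
  "t \<le> 0 \<Longrightarrow> (c1_fun \<phi> has_field_derivative hderiv (c1_fun \<phi>) t) (at t within {..0})"
  using c1_on_hist_deriv[OF c1_hist_c1_fun]
  by (simp add: has_real_derivative_iff_has_vector_derivative)

lemma hderiv_scaleR_c1hist:
  "t \<le> 0 \<Longrightarrow> hderiv (c1_fun (a *\<^sub>R \<phi>)) t = a * hderiv (c1_fun \<phi>) t"
  unfolding scaleR_c1hist.rep_eq
  by (intro hderivI has_vector_derivative_mult_right c1_on_hist_deriv c1_hist_c1_fun)

text \<open>The functions that stay below 1 on [T, 0] in absolute value together with their
  derivatives form a neighbourhood of 0. Some multiple of it absorbs \<open>B\<close>, and the
  scaling factor serves as the bound \<open>M\<close>.\<close>

lemma tvs_bounded_c1hist_bound: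
  assumes "tvs_bounded B"
  obtains M where "M > 0"
    "\<And>v t. v \<in> B \<Longrightarrow> t \<in> {T..0} \<Longrightarrow> \<bar>c1_fun v t\<bar> \<le> M \<and> \<bar>hderiv (c1_fun v) t\<bar> \<le> M"
proof -
  define N where "N = c1_jet -` (c_ball {T..0} 1 0 \<times> c_ball {T..0} 1 0)"
  have "open N"
    unfolding N_def by (intro open_c1histI open_Times open_c_ball) auto
  moreover have "0 \<in> N"
    by (simp add: N_def c1_jet_def linear_0[OF c_of_c1_linear] linear_0[OF c1_deriv_linear] c_ball_def)
  ultimately obtain r where r: "r > 0" "B \<subseteq> (*\<^sub>R) r ` N"
    using assms unfolding tvs_bounded_def by (meson order_refl)
  show thesis
  proof (rule that[OF r(1)])
    fix v t assume v: "v \<in> B" and t: "t \<in> {T..0}"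
    obtain w where w: "w \<in> N" "v = r *\<^sub>R w" using r(2) v by blast
    have "\<bar>c1_fun w t\<bar> < 1" "\<bar>hderiv (c1_fun w) t\<bar> < 1"
      using w(1) t by (auto simp: N_def c1_jet_def c_ball_def c_of_c1.rep_eq c1_deriv.rep_eq
          zero_chist.rep_eq)
    moreover have "c1_fun v t = r * c1_fun w t" "hderiv (c1_fun v) t = r * hderiv (c1_fun w) t"
      unfolding w(2) using t hderiv_scaleR_c1hist[of t r w] by (auto simp: scaleR_c1hist.rep_eq)
    ultimately show "\<bar>c1_fun v t\<bar> \<le> r \<and> \<bar>hderiv (c1_fun v) t\<bar> \<le> r"
      using r(1) by (simp add: abs_mult)
  qed
qed

text \<open>Mean value inequality on the convex set [T, 0], with one-sided derivatives at the end
  points.\<close>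

lemma c1_fun_lipschitz:
  assumes "\<And>t. t \<in> {T..0} \<Longrightarrow> \<bar>hderiv (c1_fun v) t\<bar> \<le> M" "s \<in> {T..0}" "t \<in> {T..0}"
  shows "\<bar>c1_fun v s - c1_fun v t\<bar> \<le> M * \<bar>s - t\<bar>"
proof -
  have "(c1_fun v has_field_derivative hderiv (c1_fun v) z) (at z within {T..0})"
    if "z \<in> {T..0}" for z
    using that by (intro DERIV_subset[OF c1_fun_has_field_derivative]) auto
  from field_differentiable_bound[OF _ this, of M s t] assms show ?thesis
    by auto
qed

section \<open>The extended derivative and its continuity\<close>

text \<open>The candidate for the extension of the derivative to C; \<open>h'\<close> and
  \<open>d'\<close> stand for the derivatives of \<open>h\<close> and \<open>d\<close>. Only values
  of \<eta> enter, while the derivative is taken of \<phi>, which lies in C^1.\<close>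

definition f_hd_ext ::
    "(real \<Rightarrow> real) \<Rightarrow> (real \<Rightarrow> real) \<Rightarrow> (real \<Rightarrow> real) \<Rightarrow> c1hist \<Rightarrow> chist \<Rightarrow> real" where
  "f_hd_ext h' d d' \<phi> \<eta> = h' (c1_fun \<phi> (- d (c1_fun \<phi> 0))) *
     (c_fun \<eta> (- d (c1_fun \<phi> 0)) -
      hderiv (c1_fun \<phi>) (- d (c1_fun \<phi> 0)) * d' (c1_fun \<phi> 0) * c_fun \<eta> 0)"

lemma linear_f_hd_ext: "linear (f_hd_ext h' d d' \<phi>)"
  by (rule linearI)
    (simp_all add: f_hd_ext_def plus_chist.rep_eq scaleR_chist.rep_eq algebra_simps)

context
  fixes d d' h h' :: "real \<Rightarrow> real"
  assumes d_deriv: "\<And>x. (d has_field_derivative d' x) (at x)"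
    and d'_cont: "continuous_on UNIV d'"
    and d_nonneg: "\<And>x. d x \<ge> 0"
    and h_deriv: "\<And>x. (h has_field_derivative h' x) (at x)"
    and h'_cont: "continuous_on UNIV h'"
begin

lemma tendsto_delay:
  assumes "(X \<longlongrightarrow> \<phi>) F"
  shows "((\<lambda>x. - d (c1_fun (X x) 0)) \<longlongrightarrow> - d (c1_fun \<phi> 0)) F"
  by (intro tendsto_minus isCont_tendsto_compose[OF DERIV_isCont[OF d_deriv]]
      tendsto_c1_fun_eval(1) assms tendsto_const) auto

lemma tendsto_f_hd_coefficients:
  assumes "(X \<longlongrightarrow> \<phi>) F"
  shows "((\<lambda>x. h' (c1_fun (X x) (- d (c1_fun (X x) 0)))) \<longlongrightarrow>
           h' (c1_fun \<phi> (- d (c1_fun \<phi> 0)))) F"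
    and "((\<lambda>x. hderiv (c1_fun (X x)) (- d (c1_fun (X x) 0)) * d' (c1_fun (X x) 0)) \<longlongrightarrow>
           hderiv (c1_fun \<phi>) (- d (c1_fun \<phi> 0)) * d' (c1_fun \<phi> 0)) F"
proof -
  have "isCont h' x" "isCont d' x" for x
    using h'_cont d'_cont by (simp_all add: continuous_on_eq_continuous_at)
  then show "((\<lambda>x. h' (c1_fun (X x) (- d (c1_fun (X x) 0)))) \<longlongrightarrow>
      h' (c1_fun \<phi> (- d (c1_fun \<phi> 0)))) F"
    and "((\<lambda>x. hderiv (c1_fun (X x)) (- d (c1_fun (X x) 0)) * d' (c1_fun (X x) 0)) \<longlongrightarrow>
      hderiv (c1_fun \<phi>) (- d (c1_fun \<phi> 0)) * d' (c1_fun \<phi> 0)) F"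
    by (intro tendsto_mult isCont_tendsto_compose[of _ h'] isCont_tendsto_compose[of _ d']
        tendsto_c1_fun_eval tendsto_delay assms tendsto_const; simp add: d_nonneg)+
qed

lemma tendsto_f_hd_ext:
  assumes "(X \<longlongrightarrow> \<phi>) F" "(Y \<longlongrightarrow> \<eta>) F"
  shows "((\<lambda>x. f_hd_ext h' d d' (X x) (Y x)) \<longlongrightarrow> f_hd_ext h' d d' \<phi> \<eta>) F"
  unfolding f_hd_ext_def
  by (intro tendsto_mult[OF tendsto_f_hd_coefficients(1)] tendsto_diff
      tendsto_mult[OF tendsto_f_hd_coefficients(2)] tendsto_c_fun_eval assms tendsto_delay
      tendsto_const) (simp_all add: d_nonneg)

lemma continuous_on_f_hd: "continuous_on UNIV (f_hd h d)"
  unfolding f_hd_def continuous_on_def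
  by (intro ballI isCont_tendsto_compose[OF DERIV_isCont[OF h_deriv]] tendsto_c1_fun_eval(1)
      tendsto_delay tendsto_ident_at) (simp_all add: d_nonneg)

section \<open>Directional derivatives\<close>

text \<open>Along the line \<open>\<phi> + t *\<^sub>R \<psi>\<close> the map becomes a real
  function of \<open>t\<close>, namely
  \<open>h (c1_fun \<phi> (r t) + t * c1_fun \<psi> (r t))\<close>, so one-variable calculus at
  \<open>t = 0\<close> suffices.\<close>

lemma diff_quot_f_hd:
  "(diff_quot (f_hd h d) \<phi> \<psi> \<longlongrightarrow> f_hd_ext h' d d' \<phi> (c_of_c1 \<psi>)) (at 0)"
proof -
  define p where "p = c1_fun \<phi> 0"
  define q where "q = c1_fun \<psi> 0"
  define r where "r t = - d (p + t * q)" for t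
  have r: "(r has_field_derivative - (d' p * q)) (at 0)"
  proof -
    have "((\<lambda>t. p + t * q) has_field_derivative q) (at 0)"
      by (auto intro!: derivative_eq_intros)
    from DERIV_chain2[OF d_deriv this] show ?thesis
      unfolding r_def by (intro DERIV_minus) simp
  qed
  have r0: "r t \<le> 0" for t by (simp add: r_def d_nonneg)
  have eval: "((\<lambda>t. c1_fun \<eta> (r t)) has_field_derivative
      hderiv (c1_fun \<eta>) (r 0) * - (d' p * q)) (at 0)" for \<eta>
  proof -
    \<comment> \<open>If \<open>r 0\<close> is 0, only a one-sided derivative of
      \<open>c1_fun \<eta>\<close> is available. The chain rule is therefore applied within the
      range of \<open>r\<close>, which lies in (-\<infinity>, 0] because \<open>d\<close> is
      non-negative.\<close>
    have "(c1_fun \<eta> has_field_derivative hderiv (c1_fun \<eta>) (r 0)) (at (r 0) within range r)"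
      using r0 by (intro DERIV_subset[OF c1_fun_has_field_derivative]) auto
    from DERIV_image_chain[OF this r] show ?thesis
      by (simp add: o_def)
  qed
  \<comment> \<open>In the product rule the derivative of \<psi> is multiplied by \<open>t\<close>,
    which vanishes at 0. This is why the result depends only on values of \<psi> and extends to
    C.\<close>
  have "((\<lambda>t. c1_fun \<phi> (r t) + t * c1_fun \<psi> (r t)) has_field_derivative
      hderiv (c1_fun \<phi>) (r 0) * - (d' p * q) + c1_fun \<psi> (r 0)) (at 0)"
    using DERIV_add[OF eval[of \<phi>] DERIV_mult[OF DERIV_ident eval[of \<psi>]]] by simp
  then have "((\<lambda>t. h (c1_fun \<phi> (r t) + t * c1_fun \<psi> (r t))) has_field_derivative
      h' (c1_fun \<phi> (r 0)) * (hderiv (c1_fun \<phi>) (r 0) * - (d' p * q) + c1_fun \<psi> (r 0))) (at 0)"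
    by (intro DERIV_chain2[of h]) (simp_all add: h_deriv)
  moreover have "f_hd h d (\<phi> + t *\<^sub>R \<psi>) = h (c1_fun \<phi> (r t) + t * c1_fun \<psi> (r t))" for t
    by (simp add: f_hd_def plus_c1hist.rep_eq scaleR_c1hist.rep_eq r_def p_def q_def)
  moreover have "f_hd_ext h' d d' \<phi> (c_of_c1 \<psi>) =
      h' (c1_fun \<phi> (r 0)) * (hderiv (c1_fun \<phi>) (r 0) * - (d' p * q) + c1_fun \<psi> (r 0))"
    by (simp add: f_hd_ext_def c_of_c1.rep_eq r_def p_def q_def algebra_simps)
  ultimately have "((\<lambda>t. f_hd h d (\<phi> + t *\<^sub>R \<psi>)) has_field_derivative
      f_hd_ext h' d d' \<phi> (c_of_c1 \<psi>)) (at 0)"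
    by simp
  then show ?thesis
    by (simp add: DERIV_def diff_quot_def[abs_def])
qed

lemma dir_deriv_f_hd: "dir_deriv (f_hd h d) \<phi> \<psi> = f_hd_ext h' d d' \<phi> (c_of_c1 \<psi>)"
  unfolding dir_deriv_def by (rule tendsto_Lim[OF _ diff_quot_f_hd]) simp

text \<open>The derivative is \<open>f_hd_ext h' d d' \<phi>\<close> composed with the inclusion
  \<open>c_of_c1\<close>; both maps are linear and continuous.\<close>

lemma dir_deriv_f_hd_in_Lc: "dir_deriv (f_hd h d) \<phi> \<in> Lc"
proof -
  have "((\<lambda>\<psi>. f_hd_ext h' d d' \<phi> (c_of_c1 \<psi>)) \<longlongrightarrow> f_hd_ext h' d d' \<phi> (c_of_c1 \<psi>)) (at \<psi>)" for \<psi>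
    using tendsto_ident_at[of \<psi> UNIV]
    by (intro tendsto_f_hd_ext tendsto_const) (simp add: tendsto_c1hist_iff)
  then show ?thesis
    using linear_compose[OF c_of_c1_linear linear_f_hd_ext]
    by (simp add: Lc_def dir_deriv_f_hd[abs_def] continuous_on_def o_def)
qed

section \<open>Continuity of the derivative into the topology \<beta>\<close>

text \<open>This is continuity into \<beta> in metric form. The difference of the derivatives is
  dominated on all of \<open>B\<close> by one function \<open>g\<close> of \<phi> alone, which tends
  to 0 at \<open>\<phi>\<^sub>0\<close>.\<close>

lemma dir_deriv_f_hd_beta_tendsto:
  assumes B: "tvs_bounded B" and e: "e > 0"
  shows "eventually (\<lambda>\<phi>. \<forall>v\<in>B. \<bar>dir_deriv (f_hd h d) \<phi> v - dir_deriv (f_hd h d) \<phi>\<^sub>0 v\<bar> < e)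
    (nhds \<phi>\<^sub>0)"
proof -
  define r where "r \<phi> = - d (c1_fun \<phi> 0)" for \<phi>
  define a where "a \<phi> = h' (c1_fun \<phi> (r \<phi>))" for \<phi>
  define b where "b \<phi> = hderiv (c1_fun \<phi>) (r \<phi>) * d' (c1_fun \<phi> 0)" for \<phi>
  \<comment> \<open>The margin 1 leaves room for \<open>r \<phi>\<close> with \<phi> near
    \<open>\<phi>\<^sub>0\<close>, so the bound \<open>M\<close> on the fixed interval [T, 0]
    applies at both delayed arguments.\<close>
  define T where "T = r \<phi>\<^sub>0 - 1"
  obtain M where M: "M > 0"
    "\<And>v t. v \<in> B \<Longrightarrow> t \<in> {T..0} \<Longrightarrow> \<bar>c1_fun v t\<bar> \<le> M \<and> \<bar>hderiv (c1_fun v) t\<bar> \<le> M"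
    using tvs_bounded_c1hist_bound[OF B] by blast
  have rn: "r \<phi> \<le> 0" for \<phi> by (simp add: r_def d_nonneg)
  have lim: "(r \<longlongrightarrow> r \<phi>\<^sub>0) (nhds \<phi>\<^sub>0)" "(a \<longlongrightarrow> a \<phi>\<^sub>0) (nhds \<phi>\<^sub>0)" "(b \<longlongrightarrow> b \<phi>\<^sub>0) (nhds \<phi>\<^sub>0)"
    unfolding r_def a_def b_def
    by (rule tendsto_delay tendsto_f_hd_coefficients filterlim_ident)+
  \<comment> \<open>The three summands account for the shift of the evaluation point, the change of
    the factor \<open>a\<close>, and the change of the product \<open>a * b\<close>.\<close>
  define g where "g \<phi> = M * (\<bar>a \<phi>\<bar> * \<bar>r \<phi> - r \<phi>\<^sub>0\<bar> + \<bar>a \<phi> - a \<phi>\<^sub>0\<bar> + \<bar>a \<phi> * b \<phi> - a \<phi>\<^sub>0 * b \<phi>\<^sub>0\<bar>)"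
    for \<phi>
  have "(g \<longlongrightarrow> M * (\<bar>a \<phi>\<^sub>0\<bar> * \<bar>r \<phi>\<^sub>0 - r \<phi>\<^sub>0\<bar> + \<bar>a \<phi>\<^sub>0 - a \<phi>\<^sub>0\<bar> + \<bar>a \<phi>\<^sub>0 * b \<phi>\<^sub>0 - a \<phi>\<^sub>0 * b \<phi>\<^sub>0\<bar>))
      (nhds \<phi>\<^sub>0)"
    unfolding g_def by (intro tendsto_intros lim)
  then have "(g \<longlongrightarrow> 0) (nhds \<phi>\<^sub>0)" by simp
  then have "eventually (\<lambda>\<phi>. g \<phi> < e) (nhds \<phi>\<^sub>0)" using e by (rule order_tendstoD)
  moreover have "eventually (\<lambda>\<phi>. r \<phi> > T) (nhds \<phi>\<^sub>0)"
    by (rule order_tendstoD[OF lim(1)]) (simp add: T_def)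
  ultimately show ?thesis
  proof eventually_elim
    fix \<phi> assume ge: "g \<phi> < e" and T: "r \<phi> > T"
    have mem: "r \<phi> \<in> {T..0}" "r \<phi>\<^sub>0 \<in> {T..0}" "0 \<in> {T..0}"
      using T rn[of \<phi>] rn[of \<phi>\<^sub>0] by (auto simp: T_def)
    show "\<forall>v\<in>B. \<bar>dir_deriv (f_hd h d) \<phi> v - dir_deriv (f_hd h d) \<phi>\<^sub>0 v\<bar> < e"
    proof
      fix v assume v: "v \<in> B"
      have D: "dir_deriv (f_hd h d) \<psi> v = a \<psi> * (c1_fun v (r \<psi>) - b \<psi> * c1_fun v 0)" for \<psi>
        by (simp add: dir_deriv_f_hd f_hd_ext_def a_def b_def r_def c_of_c1.rep_eq)
      have "\<bar>c1_fun v (r \<phi>) - c1_fun v (r \<phi>\<^sub>0)\<bar> \<le> M * \<bar>r \<phi> - r \<phi>\<^sub>0\<bar>"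
        using M(2)[OF v] mem by (intro c1_fun_lipschitz[of T]) auto
      then have "\<bar>a \<phi> * (c1_fun v (r \<phi>) - c1_fun v (r \<phi>\<^sub>0))\<bar> \<le> \<bar>a \<phi>\<bar> * (M * \<bar>r \<phi> - r \<phi>\<^sub>0\<bar>)"
        unfolding abs_mult by (intro mult_left_mono) auto
      moreover have "\<bar>(a \<phi> - a \<phi>\<^sub>0) * c1_fun v (r \<phi>\<^sub>0)\<bar> \<le> \<bar>a \<phi> - a \<phi>\<^sub>0\<bar> * M"
        "\<bar>(a \<phi> * b \<phi> - a \<phi>\<^sub>0 * b \<phi>\<^sub>0) * c1_fun v 0\<bar> \<le> \<bar>a \<phi> * b \<phi> - a \<phi>\<^sub>0 * b \<phi>\<^sub>0\<bar> * M"
        unfolding abs_mult using M(2)[OF v] mem by (auto intro!: mult_left_mono)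
      \<comment> \<open>Adding and subtracting \<open>a \<phi> * c1_fun v (r \<phi>\<^sub>0)\<close>
        separates the three effects bounded above.\<close>
      moreover have "dir_deriv (f_hd h d) \<phi> v - dir_deriv (f_hd h d) \<phi>\<^sub>0 v =
          a \<phi> * (c1_fun v (r \<phi>) - c1_fun v (r \<phi>\<^sub>0)) + (a \<phi> - a \<phi>\<^sub>0) * c1_fun v (r \<phi>\<^sub>0)
          - (a \<phi> * b \<phi> - a \<phi>\<^sub>0 * b \<phi>\<^sub>0) * c1_fun v 0"
        unfolding D by (simp add: algebra_simps)
      moreover have "g \<phi> = \<bar>a \<phi>\<bar> * (M * \<bar>r \<phi> - r \<phi>\<^sub>0\<bar>) + \<bar>a \<phi> - a \<phi>\<^sub>0\<bar> * M
          + \<bar>a \<phi> * b \<phi> - a \<phi>\<^sub>0 * b \<phi>\<^sub>0\<bar> * M"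
        by (simp add: g_def algebra_simps)
      ultimately show "\<bar>dir_deriv (f_hd h d) \<phi> v - dir_deriv (f_hd h d) \<phi>\<^sub>0 v\<bar> < e"
        using ge by linarith
    qed
  qed
qed

text \<open>A \<beta>-open set contains a basic neighbourhood of each of its points, given by a
  bounded set \<open>B\<close> and a neighbourhood \<open>N\<close> of 0 in the reals. Shrinking
  \<open>N\<close> to a ball of radius \<open>e\<close> reduces openness of the preimage to the
  uniform estimate on \<open>B\<close>.\<close>

lemma continuous_map_dir_deriv_f_hd:
  "continuous_map (top_of_set UNIV) beta_topology (dir_deriv (f_hd h d))"
  unfolding continuous_map_def
proof (intro conjI allI impI)
  show "dir_deriv (f_hd h d) \<in> topspace (top_of_set UNIV) \<rightarrow> topspace beta_topology"
    by (simp add: topspace_beta_topology dir_deriv_f_hd_in_Lc)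
next
  fix G :: "(c1hist \<Rightarrow> real) set" assume "openin beta_topology G"
  then have G: "beta_open G" by (simp add: openin_beta_topology)
  have "eventually (\<lambda>\<phi>. dir_deriv (f_hd h d) \<phi> \<in> G) (nhds \<phi>\<^sub>0)"
    if mem: "dir_deriv (f_hd h d) \<phi>\<^sub>0 \<in> G" for \<phi>\<^sub>0
  proof -
    obtain B N where BN: "tvs_bounded B" "open N" "0 \<in> N"
      "\<forall>A\<in>Lc. (\<lambda>v. A v - dir_deriv (f_hd h d) \<phi>\<^sub>0 v) ` B \<subseteq> N \<longrightarrow> A \<in> G"
      using G mem unfolding beta_open_def by meson
    obtain e where e: "e > 0" "ball 0 e \<subseteq> N"
      using BN(2,3) by (meson openE)
    show ?thesis
      using dir_deriv_f_hd_beta_tendsto[OF BN(1) e(1)]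
    proof eventually_elim
      case (elim \<phi>)
      have "(\<lambda>v. dir_deriv (f_hd h d) \<phi> v - dir_deriv (f_hd h d) \<phi>\<^sub>0 v) ` B \<subseteq> ball 0 e"
        using elim by (auto simp: dist_real_def)
      then show ?case
        using e(2) by (intro BN(4)[rule_format] dir_deriv_f_hd_in_Lc) blast
    qed
  qed
  then have "open {\<phi>. dir_deriv (f_hd h d) \<phi> \<in> G}"
    by (subst open_subopen) (simp add: eventually_nhds subset_eq)
  then show "openin (top_of_set UNIV)
      {\<phi> \<in> topspace (top_of_set UNIV). dir_deriv (f_hd h d) \<phi> \<in> G}"
    by simp
qed

lemma C1F_smooth_on_f_hd: "C1F_smooth_on UNIV (f_hd h d)"
  unfolding C1F_smooth_on_def
  using continuous_on_f_hd diff_quot_f_hd dir_deriv_f_hd_in_Lc continuous_map_dir_deriv_f_hd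
  by blast

lemma property_e_f_hd: "property_e UNIV (f_hd h d)"
proof -
  have "continuous_on UNIV (\<lambda>(\<phi>, \<eta>). f_hd_ext h' d d' \<phi> \<eta>)"
    unfolding continuous_on_def case_prod_beta
    by (intro ballI tendsto_f_hd_ext tendsto_fst tendsto_snd tendsto_ident_at)
  then show ?thesis
    unfolding property_e_def
    by (intro exI[of _ "f_hd_ext h' d d'"]) (simp add: linear_f_hd_ext dir_deriv_f_hd)
qed

end

theorem corollary9p2:
  fixes d h :: "real \<Rightarrow> real"
  assumes "d C1_differentiable_on UNIV"
    and "range d \<subseteq> {0..}"
    and "h C1_differentiable_on UNIV"
  shows "C1F_smooth_on UNIV (f_hd h d) \<and> property_e UNIV (f_hd h d)"
proof -
  \<comment> \<open>\<open>C1_differentiable_on\<close> supplies a continuous vector derivative,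
    which for real functions is the same as a field derivative.\<close>
  obtain d' where d': "\<And>x. (d has_field_derivative d' x) (at x)" "continuous_on UNIV d'"
    using assms(1)
    by (auto simp: C1_differentiable_on_def has_real_derivative_iff_has_vector_derivative)
  obtain h' where h': "\<And>x. (h has_field_derivative h' x) (at x)" "continuous_on UNIV h'"
    using assms(3)
    by (auto simp: C1_differentiable_on_def has_real_derivative_iff_has_vector_derivative)
  have "d x \<ge> 0" for x using assms(2) by auto
  with d' h' show ?thesis
    using C1F_smooth_on_f_hd property_e_f_hd by blast
qed

end
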